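(* Let $M_1$ and $M_2$ be Orlicz functions. Suppose that for $i\in\{1,2\}$, $M_i$ is $\mathcal{C}^3$ on $[0,+\infty)$, $M_i^{(3)}$ is increasing, $M_i(t)=o(t^3)$ when $t\to 0$, and $M_i$ satisfies the $\Delta_{2++}$-condition at $0$. Let $X=\ell_{M_1}$ or $X=\ell_{M_1}^n$ for some $n\in\mathbb{N}$. Then every linear isometric embedding $T\colon X\to\ell_{M_2}$ preserves disjointness, i.e. $T(f)$ and $T(g)$ are disjoint whenever $f,g\in X$ are disjoint.
   Context: All spaces are real. An Orlicz function is a convex function $M\colon[0,+\infty)\to[0,+\infty)$ with $M(0)=0$ and $\lim_{t\to\infty}M(t)=\infty$. For a real sequence $x=(x(k))_{k\in\mathbb{N}}$, the Luxemburg norm is $\|x\|_M=\inf\{\rho>0 : \sum_k M(|x(k)|/\rho)\leqslant 1\}$ (with $\inf\varnothing=+\infty$); the Orlicz sequence space is $\ell_M=\{x\in\mathbb{R}^{\mathbb{N}} : \|x\|_M<\infty\}$ with the norm $\|\cdot\|_M$. The space $\ell_M^n$ is $\mathbb{R}^n$ with the norm defined in the same way on sequences indexed by $\{1,\dots,n\}$. The support of $x$ is $\{k : x(k)\neq 0\}$; two vectors are disjoint if their supports are disjoint. An Orlicz function $M$ of class $\mathcal{C}^3$ on $(0,+\infty)$ satisfies the $\Delta_{2++}$-condition at $0$ if for every $i\in\{1,2,3\}$, $\limsup_{t\to 0}\frac{tM^{(i)}(t)}{M^{(i-1)}(t)}<\infty$. *)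

theory Defs
  imports "HOL-Analysis.Analysis" "HOL-Library.Landau_Symbols"
begin

text \<open>
  A function on \<open>[0,\<infinity>)\<close> is represented by a total function \<^typ>\<open>real \<Rightarrow> real\<close> whose values on
  negative arguments are irrelevant.
\<close>

definition orlicz_function :: "(real \<Rightarrow> real) \<Rightarrow> bool" where
  "orlicz_function M \<longleftrightarrow>
     convex_on {0..} M \<and> (\<forall>t\<ge>0. 0 \<le> M t) \<and> M 0 = 0 \<and> filterlim M at_top at_top"

text \<open>
  The \<open>i\<close>-th derivative on \<open>[0,\<infinity>)\<close>: one-sided at \<open>0\<close>, and the ordinary iterated derivative at
  every \<open>t > 0\<close>.
\<close>

definition half_line_deriv :: "nat \<Rightarrow> (real \<Rightarrow> real) \<Rightarrow> real \<Rightarrow> real" where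
  "half_line_deriv i M = ((\<lambda>f t. vector_derivative f (at t within {0..})) ^^ i) M"

definition C3_half_line :: "(real \<Rightarrow> real) \<Rightarrow> bool" where
  "C3_half_line M \<longleftrightarrow>
     (\<forall>i<3. half_line_deriv i M differentiable_on {0..}) \<and>
     continuous_on {0..} (half_line_deriv 3 M)"

text \<open>
  The quotients are required to be defined near \<open>0\<close>. Without this clause the convention
  \<open>x / 0 = 0\<close> would let functions that vanish identically near \<open>0\<close> satisfy the condition.
\<close>

definition delta2pp_at_0 :: "(real \<Rightarrow> real) \<Rightarrow> bool" where
  "delta2pp_at_0 M \<longleftrightarrow>
     (\<forall>i\<in>{1,2,3}.
        (\<forall>\<^sub>F t in at_right 0. half_line_deriv (i - 1) M t \<noteq> 0) \<and>
        Limsup (at_right 0)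
          (\<lambda>t. ereal (t * half_line_deriv i M t / half_line_deriv (i - 1) M t)) < \<infinity>)"

text \<open>
  The set \<open>I\<close> is the index set of the sequences. In \<^typ>\<open>ereal\<close>, \<^term>\<open>Inf {} = (\<infinity>::ereal)\<close>.
\<close>

definition luxemburg_norm :: "(real \<Rightarrow> real) \<Rightarrow> nat set \<Rightarrow> (nat \<Rightarrow> real) \<Rightarrow> ereal" where
  "luxemburg_norm M I x =
     Inf {ereal \<rho> |\<rho>. 0 < \<rho> \<and> (\<Sum>\<^sub>\<infinity>k\<in>I. ennreal (M (\<bar>x k\<bar> / \<rho>))) \<le> 1}"

text \<open>
  Real sequences indexed by \<open>I\<close> are represented by functions on \<^typ>\<open>nat\<close> vanishing outside \<open>I\<close>.
\<close>

definition orlicz_space_on :: "(real \<Rightarrow> real) \<Rightarrow> nat set \<Rightarrow> (nat \<Rightarrow> real) set" where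
  "orlicz_space_on M I = {x. (\<forall>k. k \<notin> I \<longrightarrow> x k = 0) \<and> luxemburg_norm M I x < \<infinity>}"

text \<open>
  The space \<open>\<ell>\<^sub>M\<close> is \<^term>\<open>orlicz_space_on M UNIV\<close>, and \<open>\<ell>\<^sub>M\<^sup>n\<close> is \<^term>\<open>orlicz_space_on M {..<n}\<close>
  (coordinates numbered from \<open>0\<close>).
\<close>

definition linear_isometric_embedding ::
  "(real \<Rightarrow> real) \<Rightarrow> nat set \<Rightarrow> (real \<Rightarrow> real) \<Rightarrow> nat set \<Rightarrow>
   ((nat \<Rightarrow> real) \<Rightarrow> (nat \<Rightarrow> real)) \<Rightarrow> bool" where
  "linear_isometric_embedding M I N J T \<longleftrightarrow>
     T \<in> orlicz_space_on M I \<rightarrow> orlicz_space_on N J \<and>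
     (\<forall>x\<in>orlicz_space_on M I. \<forall>y\<in>orlicz_space_on M I.
        T (\<lambda>k. x k + y k) = (\<lambda>k. T x k + T y k)) \<and>
     (\<forall>c. \<forall>x\<in>orlicz_space_on M I. T (\<lambda>k. c * x k) = (\<lambda>k. c * T x k)) \<and>
     (\<forall>x\<in>orlicz_space_on M I. luxemburg_norm N J (T x) = luxemburg_norm M I x)"

definition disjoint_seqs :: "(nat \<Rightarrow> real) \<Rightarrow> (nat \<Rightarrow> real) \<Rightarrow> bool" where
  "disjoint_seqs x y \<longleftrightarrow> {k. x k \<noteq> 0} \<inter> {k. y k \<noteq> 0} = {}"

end

theory Submission
  imports Defs
begin

text \<open>
  The argument compares how fast \<open>\<parallel>f + s g\<parallel>\<close> can grow with \<open>s\<close>, for disjoint and for overlapping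
  vectors. Write \<open>n = \<parallel>f\<parallel>\<close>.

  Call \<open>\<Sum>k. M (\<bar>x k\<bar> / \<rho>)\<close> the modular of \<open>x\<close> at the level \<open>\<rho>\<close>, and \<open>\<rho>\<close> admissible for \<open>x\<close> if this is at
  most \<open>1\<close>; the norm is the infimum of the admissible levels.

  If \<open>f\<close> and \<open>g\<close> are disjoint, the modular of \<open>f + s g\<close> is the sum of the modulars of \<open>f\<close> and \<open>s g\<close>.
  Since \<open>M\<^sup>(\<^sup>3\<^sup>)\<close> is increasing and \<open>M\<close> vanishes at \<open>0\<close> together with its first two derivatives,
  \<open>M (s t) \<le> s\<^sup>3 M t\<close> for \<open>s \<in> [0,1]\<close>; hence the second modular is \<open>O(s\<^sup>3)\<close> and
  \<open>\<parallel>f \<plusminus> s g\<parallel> \<le> n (1 + O(s\<^sup>3))\<close>. This is \<open>luxemburg_norm_add_disjoint\<close>.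

  If \<open>F\<close> and \<open>G\<close> overlap and \<open>\<parallel>F\<parallel> = n\<close>, consider the second difference of the modular between
  \<open>F + s G\<close>, \<open>F\<close> and \<open>F - s G\<close>. By convexity every coordinate contributes a nonnegative amount to it,
  and a coordinate \<open>k\<close> with \<open>F k \<noteq> 0 \<noteq> G k\<close> contributes at least \<open>\<kappa> s\<^sup>2\<close> with \<open>\<kappa> > 0\<close>, because \<open>M''\<close> is
  increasing and positive on \<open>(0,\<infinity>)\<close>. If both \<open>F + s G\<close> and \<open>F - s G\<close> have norm at most
  \<open>n (1 + O(s\<^sup>3))\<close>, then the modular of \<open>F\<close> at the level \<open>n\<close> falls short of \<open>1\<close> by a multiple of \<open>s\<^sup>2\<close>, up to an error
  \<open>O(s\<^sup>3)\<close>. The \<open>\<Delta>\<^sub>2\<close>-estimate \<open>t M' t \<le> C M t\<close> turns this deficit into \<open>\<parallel>F\<parallel> < n\<close>. So one of the two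
  signs gives a norm above that bound: this is \<open>luxemburg_norm_add_overlapping\<close>.

  An isometry \<open>T\<close> transports the first bound from \<open>f, g\<close> to \<open>F = T f, G = T g\<close>, so these cannot overlap.
\<close>

section \<open>Orlicz functions with increasing third derivative\<close>

lemma nonneg_if_deriv_nonneg:
  fixes f f' :: "real \<Rightarrow> real"
  assumes "continuous_on {0..} f" "0 \<le> f 0"
    and "\<And>t. 0 < t \<Longrightarrow> (f has_real_derivative f' t) (at t)"
    and "\<And>t. 0 \<le> t \<Longrightarrow> 0 \<le> f' t"
    and "0 \<le> t"
  shows "0 \<le> f t"
proof (cases "t = 0")
  case False
  then have "f 0 \<le> f t"
    using assms by (intro DERIV_nonneg_imp_increasing_open[of 0 t f])
      (auto intro: continuous_on_subset less_imp_le)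
  then show ?thesis using assms(2) by simp
qed (use assms in auto)

locale smooth_orlicz =
  fixes M :: "real \<Rightarrow> real"
  assumes orlicz: "orlicz_function M"
    and smooth: "C3_half_line M"
    and third_mono: "mono_on {0..} (half_line_deriv 3 M)"
    and small_cubic: "M \<in> o[at_right 0](\<lambda>t. t ^ 3)"
    and delta2pp: "delta2pp_at_0 M"
begin

abbreviation D :: "nat \<Rightarrow> real \<Rightarrow> real" where
  "D i \<equiv> half_line_deriv i M"

lemma D_0: "D 0 = M"
  by (simp add: half_line_deriv_def)

lemma D_Suc_within:
  assumes "i < 3" "0 \<le> t"
  shows "(D i has_real_derivative D (Suc i) t) (at t within {0..})"
proof -
  have "D i differentiable (at t within {0..})"
    using smooth assms by (auto simp: C3_half_line_def differentiable_on_def)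
  then show ?thesis
    by (simp add: half_line_deriv_def vector_derivative_works
        has_real_derivative_iff_has_vector_derivative)
qed

lemma D_Suc:
  assumes "i < 3" "0 < t"
  shows "(D i has_real_derivative D (Suc i) t) (at t)"
  using D_Suc_within[OF assms(1), of t] assms(2) at_within_interior[of t "{0..}"] by simp

lemma D_continuous: "i \<le> 3 \<Longrightarrow> continuous_on {0..} (D i)"
  using smooth by (cases "i = 3")
    (auto simp: C3_half_line_def intro: differentiable_imp_continuous_on)

lemma D_tendsto: "i \<le> 3 \<Longrightarrow> (D i \<longlongrightarrow> D i 0) (at_right 0)"
  using D_continuous[of i] unfolding continuous_on_def
  by (metis atLeast_iff greaterThan_iff less_imp_le order_refl subsetI tendsto_within_subset)

text \<open>
  L'Hopital's rule at \<open>0\<close>. Iterated, it recovers every derivative at \<open>0\<close> from the growth of \<open>M\<close> itself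
  without a two-sided Taylor expansion.
\<close>

lemma quotient_lift:
  assumes "i < 3" "D i 0 = 0"
    and "((\<lambda>t. D (Suc i) t / t ^ k) \<longlongrightarrow> c) (at_right 0)"
  shows "((\<lambda>t. D i t / t ^ Suc k) \<longlongrightarrow> c / Suc k) (at_right 0)"
proof (rule lhopital_right_0[where f' = "D (Suc i)" and g' = "\<lambda>t. real (Suc k) * t ^ k"])
  show "(D i \<longlongrightarrow> 0) (at_right 0)"
    using D_tendsto[of i] assms by simp
  show "((\<lambda>t::real. t ^ Suc k) \<longlongrightarrow> 0) (at_right 0)"
    by (rule tendsto_eq_intros refl | simp)+
  show "\<forall>\<^sub>F t in at_right 0. (D i has_real_derivative D (Suc i) t) (at t)"
    using D_Suc[OF assms(1)] by (auto simp: eventually_at_filter)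
  show "\<forall>\<^sub>F t::real in at_right 0. ((\<lambda>t. t ^ Suc k) has_real_derivative real (Suc k) * t ^ k) (at t)"
    using DERIV_pow[of "Suc k"] by simp
  show "((\<lambda>t. D (Suc i) t / (real (Suc k) * t ^ k)) \<longlongrightarrow> c / Suc k) (at_right 0)"
    using tendsto_divide[OF assms(3) tendsto_const[of "real (Suc k)"]]
    by (simp add: mult.commute)
  show "\<forall>\<^sub>F t::real in at_right 0. t ^ Suc k \<noteq> 0"
    "\<forall>\<^sub>F t::real in at_right 0. real (Suc k) * t ^ k \<noteq> 0"
    by (rule eventually_mono[OF eventually_at_right_less[of 0]]; simp)+
qed

lemma D_quotient_tendsto:
  assumes "k \<le> i" "i \<le> 3" "\<And>j. j < i \<Longrightarrow> D j 0 = 0"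
  shows "((\<lambda>t. D (i - k) t / t ^ k) \<longlongrightarrow> D i 0 / fact k) (at_right 0)"
  using assms(1)
proof (induction k)
  case 0
  then show ?case using D_tendsto[OF assms(2)] by simp
next
  case (Suc k)
  have "Suc (i - Suc k) = i - k" using Suc.prems by simp
  then show ?case
    using quotient_lift[of "i - Suc k" k "D i 0 / fact k"] Suc assms(2) assms(3)[of "i - Suc k"]
    by (simp add: algebra_simps)
qed

lemma M_quotient_tendsto_0:
  assumes "j \<le> 3"
  shows "((\<lambda>t. M t / t ^ j) \<longlongrightarrow> 0) (at_right 0)"
proof -
  have "((\<lambda>t. M t / t ^ 3) \<longlongrightarrow> 0) (at_right 0)"
    using small_cubic by (rule smalloD_tendsto)
  from tendsto_mult[OF this tendsto_power[OF tendsto_ident_at, of "3 - j"]]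
  have "((\<lambda>t. M t / t ^ 3 * t ^ (3 - j)) \<longlongrightarrow> 0) (at_right 0)"
    by simp
  moreover have "\<forall>\<^sub>F t in at_right 0. M t / t ^ 3 * t ^ (3 - j) = M t / t ^ j"
    unfolding eventually_at_filter
  proof (intro always_eventually allI impI)
    fix t :: real assume "t \<noteq> 0"
    moreover have "t ^ 3 = t ^ (3 - j) * t ^ j"
      using assms by (simp flip: power_add)
    ultimately show "M t / t ^ 3 * t ^ (3 - j) = M t / t ^ j"
      by simp
  qed
  ultimately show ?thesis
    by (rule Lim_transform_eventually)
qed

text \<open>
  By induction on \<open>i\<close>, the quotient \<open>M t / t\<^sup>i\<close> tends to \<open>D i 0 / i!\<close> once the lower derivatives vanish;
  it also tends to \<open>0\<close>, since \<open>M t = o(t\<^sup>3)\<close>.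
\<close>

lemma derivs_vanish_at_0: "i \<le> 3 \<Longrightarrow> D i 0 = 0"
proof (induction i rule: less_induct)
  case (less i)
  then have "((\<lambda>t. M t / t ^ i) \<longlongrightarrow> D i 0 / fact i) (at_right 0)"
    using D_quotient_tendsto[of i i] by (simp add: D_0)
  from tendsto_unique[OF _ this M_quotient_tendsto_0] show ?case
    using less.prems by simp
qed

lemma D_nonneg: "i \<le> 3 \<Longrightarrow> 0 \<le> t \<Longrightarrow> 0 \<le> D i t"
proof (induction arbitrary: t rule: inc_induct)
  case base
  then show ?case
    using mono_onD[OF third_mono, of 0 t] derivs_vanish_at_0[of 3] by simp
next
  case (step i)
  then show ?case
    using nonneg_if_deriv_nonneg[of "D i" "D (Suc i)" t] D_Suc[of i] derivs_vanish_at_0[of i] D_continuous[of i]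
    by simp
qed

lemma D_mono:
  assumes "i < 3" "0 \<le> s" "s \<le> t"
  shows "D i s \<le> D i t"
proof (cases "s = t")
  case False
  have "\<exists>y. (D i has_real_derivative y) (at u) \<and> 0 \<le> y" if "s < u" for u
    using D_Suc[OF assms(1), of u] D_nonneg[of "Suc i" u] that assms by (intro exI[of _ "D (Suc i) u"]) simp
  moreover have "continuous_on {s..t} (D i)"
    using continuous_on_subset[OF D_continuous[of i]] assms by simp
  ultimately show ?thesis
    using False assms by (intro DERIV_nonneg_imp_increasing_open[of s t "D i"]) auto
qed simp

lemmas M_mono = D_mono[of 0, simplified D_0, simplified]

text \<open>
  The \<open>\<Delta>\<^sub>2\<^sub>+\<^sub>+\<close>-condition makes \<open>D i\<close> nonzero near \<open>0\<close>, and monotonicity carries the positive sign to the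
  whole half-line.
\<close>

lemma D_pos:
  assumes "i < 3" "0 < t"
  shows "0 < D i t"
proof -
  have "\<forall>\<^sub>F u in at_right 0. D i u \<noteq> 0"
    using delta2pp[unfolded delta2pp_at_0_def, THEN bspec, of "Suc i"] assms(1) by force
  then obtain b where b: "0 < b" "\<And>u. 0 < u \<Longrightarrow> u < b \<Longrightarrow> D i u \<noteq> 0"
    unfolding eventually_at_right_field by auto
  define u where "u = min t (b / 2)"
  have u: "0 < u" "u < b" "u \<le> t" using assms b(1) by (auto simp: u_def)
  have "0 \<le> D i u" using D_nonneg assms u by simp
  then have "0 < D i u" using b(2) u by force
  also have "\<dots> \<le> D i t" using D_mono assms u by simp
  finally show ?thesis .
qed

text \<open>
  The function \<open>E 0 t = s\<^sup>3 M t - M (s t)\<close> has third derivative \<open>s\<^sup>3 (D 3 t - D 3 (s t)) \<ge> 0\<close> and vanishes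
  at \<open>0\<close> with its first two derivatives \<open>E 1\<close> and \<open>E 2\<close>, so three integrations give \<open>E 0 \<ge> 0\<close>.
\<close>

lemma cubic_contraction:
  assumes "0 \<le> s" "s \<le> 1" "0 \<le> t"
  shows "M (s * t) \<le> s ^ 3 * M t"
proof -
  define E where "E i t = s ^ 3 * D i t - s ^ i * D i (s * t)" for i t
  have cont: "continuous_on {0..} (E i)" if "i < 3" for i
    unfolding E_def using that assms
    by (intro continuous_intros D_continuous continuous_on_compose2[OF D_continuous[of i]]) auto
  have at0: "E i 0 = 0" if "i < 3" for i
    using derivs_vanish_at_0[of i] that by (simp add: E_def)
  have deriv: "(E i has_real_derivative E (Suc i) t) (at t)" if "i < 3" "0 < t" "0 < s" for i t
  proof -
    have "((\<lambda>t. D i (s * t)) has_real_derivative D (Suc i) (s * t) * s) (at t)"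
      using that by (intro DERIV_chain2[OF D_Suc]) (auto intro!: derivative_eq_intros)
    from DERIV_diff[OF DERIV_cmult[OF D_Suc[OF that(1,2)], of "s ^ 3"] DERIV_cmult[OF this, of "s ^ i"]]
    show ?thesis
      by (simp add: E_def[abs_def] mult_ac)
  qed
  have "0 \<le> E i t" if "i \<le> 3" "0 \<le> t" "0 < s" for i t
    using that(1,2)
  proof (induction arbitrary: t rule: inc_induct)
    case base
    have "D 3 (s * t) \<le> D 3 t"
      using assms base by (intro mono_onD[OF third_mono]) (auto intro: mult_left_le_one_le)
    then show ?case
      using assms unfolding E_def by (simp add: mult_left_mono)
  next
    case (step i)
    then show ?case
      using nonneg_if_deriv_nonneg[OF cont _ deriv, of i t] at0 \<open>0 < s\<close> by simp
  qed
  from this[of 0 t] show ?thesis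
    using derivs_vanish_at_0[of 0] assms by (cases "s = 0") (auto simp: E_def D_0)
qed

text \<open>
  Convexity and monotonicity on \<open>[0,\<infinity>)\<close> make \<open>t \<mapsto> M \<bar>t\<bar>\<close> midpoint convex on the whole line.
\<close>

lemma midpoint_convex: "2 * M \<bar>x\<bar> \<le> M \<bar>x + h\<bar> + M \<bar>x - h\<bar>"
proof -
  have "M \<bar>x\<bar> \<le> M ((1 - 1/2) *\<^sub>R \<bar>x + h\<bar> + (1/2) *\<^sub>R \<bar>x - h\<bar>)"
    using abs_triangle_ineq[of "x + h" "x - h"] by (intro M_mono) (auto simp: abs_mult)
  also have "\<dots> \<le> (1 - 1/2) * M \<bar>x + h\<bar> + (1/2) * M \<bar>x - h\<bar>"
    using orlicz by (intro convex_onD[of "{0..}"]) (auto simp: orlicz_function_def)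
  finally show ?thesis by simp
qed

text \<open>
  Away from \<open>0\<close> the gain is quadratic: for \<open>x \<ge> a\<close> and \<open>h \<le> x / 2\<close> the points \<open>x \<plusminus> h\<close> stay above \<open>a / 2\<close>,
  where \<open>M''\<close> is at least \<open>M'' (a / 2) > 0\<close>.
\<close>

lemma strong_midpoint_convex:
  assumes "0 < a"
  obtains m where "0 < m"
    and "\<And>x h. a \<le> x \<Longrightarrow> 0 \<le> h \<Longrightarrow> h \<le> x / 2 \<Longrightarrow> 2 * M x + m * h\<^sup>2 \<le> M (x + h) + M (x - h)"
proof
  define m where "m = D 2 (a / 2)"
  show "0 < D 2 (a / 2)" using D_pos assms by simp
  fix x h assume x: "a \<le> x" and h: "0 \<le> h" "h \<le> x / 2"
  define \<phi> where "\<phi> h = M (x + h) + M (x - h) - 2 * M x - m * h\<^sup>2" for h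
  have deriv: "(\<phi> has_real_derivative D 1 (x + k) - D 1 (x - k) - 2 * m * k) (at k)"
    if k: "0 \<le> k" "k \<le> x / 2" for k
  proof -
    have "x + k > 0" "x - k > 0" using k assms x by auto
    note * = D_Suc[of 0, OF _ this(1), simplified D_0, simplified]
      D_Suc[of 0, OF _ this(2), simplified D_0, simplified]
    have "((\<lambda>k. M (x + k)) has_real_derivative D 1 (x + k) * 1) (at k)"
      using * by (intro DERIV_chain2) (auto intro!: derivative_eq_intros)
    moreover have "((\<lambda>k. M (x - k)) has_real_derivative D 1 (x - k) * (-1)) (at k)"
      using * by (intro DERIV_chain2) (auto intro!: derivative_eq_intros)
    ultimately show ?thesis
      unfolding \<phi>_def[abs_def] by (auto intro!: derivative_eq_intros)
  qed
  have "0 \<le> D 1 (x + k) - D 1 (x - k) - 2 * m * k" if k: "0 \<le> k" "k \<le> x / 2" for k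
  proof (cases "k = 0")
    case False
    have "\<exists>z. x - k < z \<and> z < x + k \<and> D 1 (x + k) - D 1 (x - k) = (x + k - (x - k)) * D 2 z"
    proof (rule MVT2)
      show "x - k < x + k" using k False by simp
      show "(D 1 has_real_derivative D 2 z) (at z)" if "x - k \<le> z" for z
        using D_Suc[of 1 z] that k x assms by (simp add: numeral_2_eq_2)
    qed
    then obtain z where z: "x - k < z" "D 1 (x + k) - D 1 (x - k) = 2 * k * D 2 z"
      by auto
    have "m \<le> D 2 z" unfolding m_def using z(1) k x assms by (intro D_mono) auto
    then show ?thesis unfolding z(2) using k mult_right_mono[of m "D 2 z" k] by (simp add: mult.commute)
  qed simp
  then have "\<exists>y. (\<phi> has_real_derivative y) (at k) \<and> 0 \<le> y" if "0 \<le> k" "k \<le> h" for k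
    using deriv[of k] that h(2) order_trans by blast
  then have "\<phi> 0 \<le> \<phi> h"
    using h(1) by (rule DERIV_nonneg_imp_nondecreasing[rotated])
  then show "2 * M x + D 2 (a / 2) * h\<^sup>2 \<le> M (x + h) + M (x - h)"
    by (simp add: \<phi>_def m_def)
qed

text \<open>
  The mean value theorem bounds \<open>M t - M (s t)\<close> by \<open>(1 - s) t M' t\<close>, and \<open>t M' t \<le> C M t\<close> holds on
  bounded intervals: near \<open>0\<close> by the \<open>\<Delta>\<^sub>2\<close>-condition, and further out because \<open>t M' t\<close> is bounded while
  \<open>M\<close> stays away from \<open>0\<close>. Thus a dilation by \<open>1 - \<delta>\<close> costs only a relative amount \<open>C \<delta>\<close>, which relates
  a change of the norm to a proportional change of the modular.
\<close>

lemma delta2_lower: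
  obtains C where "0 \<le> C"
    and "\<And>s t. 0 \<le> s \<Longrightarrow> s \<le> 1 \<Longrightarrow> 0 \<le> t \<Longrightarrow> t \<le> R \<Longrightarrow> (1 - (1 - s) * C) * M t \<le> M (s * t)"
proof -
  have "Limsup (at_right 0) (\<lambda>t. ereal (t * D 1 t / D 0 t)) < \<infinity>"
    using delta2pp unfolding delta2pp_at_0_def by (metis diff_self_eq_0 insertI1)
  then obtain B where "Limsup (at_right 0) (\<lambda>t. ereal (t * D 1 t / D 0 t)) < ereal B"
    using less_PInf_Ex_of_nat by (metis of_nat_id ereal_less_PInfty ereal_dense2)
  then have "\<forall>\<^sub>F t in at_right 0. t * D 1 t / D 0 t < B"
    using Limsup_lessD by fastforce
  then obtain b where b: "0 < b" "\<And>t. 0 < t \<Longrightarrow> t < b \<Longrightarrow> t * D 1 t / M t < B"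
    unfolding eventually_at_right_field D_0 by auto
  define C where "C = max 0 (max B (R * D 1 R / M b))"
  have C: "t * D 1 t \<le> C * M t" if t: "0 < t" "t \<le> R" for t
  proof -
    have Mt: "0 < M t" using D_pos[of 0 t] t by (simp add: D_0)
    have Mb: "0 < M b" using D_pos[of 0 b] b by (simp add: D_0)
    show ?thesis
    proof (cases "t < b")
      case True
      then have "t * D 1 t < B * M t" using b(2)[of t] t Mt by (simp add: field_simps)
      also have "\<dots> \<le> C * M t" using Mt by (simp add: C_def)
      finally show ?thesis by simp
    next
      case False
      have "t * D 1 t \<le> R * D 1 R" using t D_mono[of 1 t R] D_nonneg[of 1 t] by (intro mult_mono) auto
      also have "\<dots> = R * D 1 R / M b * M b" using Mb by simp
      also have "\<dots> \<le> C * M b" using Mb by (intro mult_right_mono) (auto simp: C_def)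
      also have "\<dots> \<le> C * M t" using M_mono[of b t] False b by (intro mult_left_mono) (auto simp: C_def)
      finally show ?thesis .
    qed
  qed
  show ?thesis
  proof
    show "0 \<le> C" by (simp add: C_def)
    fix s t :: real assume s: "0 \<le> s" "s \<le> 1" and t: "0 \<le> t" "t \<le> R"
    show "(1 - (1 - s) * C) * M t \<le> M (s * t)"
    proof (cases "s = 1 \<or> t = 0")
      case True
      then show ?thesis using derivs_vanish_at_0[of 0] by (auto simp: D_0)
    next
      case False
      then have st: "s < 1" "0 < t" using s t by auto
      then have "s * t < t" by simp
      moreover have "continuous_on {s * t..t} M"
        using continuous_on_subset[OF D_continuous[of 0]] s t by (simp add: D_0)
      ultimately obtain z where z: "s * t < z" "z < t" "M t - M (s * t) = (t - s * t) * D 1 z"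
        using MVT[of "s * t" t M] D_Suc[of 0] s t D_0
        by (smt (verit) DERIV_unique One_nat_def mult_nonneg_nonneg real_differentiable_def zero_less_numeral)
      have "0 \<le> z" using z(1) s t by (smt (verit) mult_nonneg_nonneg)
      then have "(t - s * t) * D 1 z \<le> (t - s * t) * D 1 t"
        using z st D_mono[of 1 z t] by (intro mult_left_mono) auto
      also have "\<dots> = (1 - s) * (t * D 1 t)" by (simp add: algebra_simps)
      also have "\<dots> \<le> (1 - s) * (C * M t)" using C st t by (intro mult_left_mono) auto
      finally show ?thesis using z(3) by (simp add: algebra_simps)
    qed
  qed
qed

lemma bounded_sublevel:
  obtains R where "\<And>t. 0 \<le> t \<Longrightarrow> M t \<le> 1 \<Longrightarrow> t \<le> R"
proof -
  have "\<forall>\<^sub>F t in at_top. 1 < M t"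
    using orlicz unfolding orlicz_function_def filterlim_at_top_dense by blast
  then obtain R where "\<And>t. R \<le> t \<Longrightarrow> 1 < M t" unfolding eventually_at_top_linorder by auto
  then show ?thesis using that[of R] by (meson linorder_not_le nle_le order_less_le)
qed

section \<open>The Luxemburg norm\<close>

text \<open>
  All later estimates concern finite real sums: this removes the infinite sums and the extended reals.
\<close>

lemma infsum_le_1_iff:
  "(\<Sum>\<^sub>\<infinity>k\<in>I. ennreal (M (\<bar>x k\<bar> / \<rho>))) \<le> 1 \<longleftrightarrow>
     (\<forall>A. finite A \<and> A \<subseteq> I \<longrightarrow> (\<Sum>k\<in>A. M (\<bar>x k\<bar> / \<rho>)) \<le> 1)" if "0 < \<rho>"
proof -
  have "(\<Sum>k\<in>A. ennreal (M (\<bar>x k\<bar> / \<rho>))) = ennreal (\<Sum>k\<in>A. M (\<bar>x k\<bar> / \<rho>))" for A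
    using D_nonneg[of 0] that by (intro sum_ennreal) (simp add: D_0)
  then show ?thesis
    by (subst nonneg_infsum_complete) (simp_all add: SUP_le_iff)
qed

lemma luxemburg_normI:
  assumes "0 < \<rho>" "\<And>A. finite A \<Longrightarrow> A \<subseteq> I \<Longrightarrow> (\<Sum>k\<in>A. M (\<bar>x k\<bar> / \<rho>)) \<le> 1"
  shows "luxemburg_norm M I x \<le> ereal \<rho>"
proof -
  have "(\<Sum>\<^sub>\<infinity>k\<in>I. ennreal (M (\<bar>x k\<bar> / \<rho>))) \<le> 1"
    using assms infsum_le_1_iff[of \<rho> x I] by simp
  then show ?thesis
    unfolding luxemburg_norm_def using assms(1) by (intro Inf_lower) auto
qed

lemma luxemburg_normD:
  assumes "luxemburg_norm M I x < ereal \<rho>"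
  shows "0 < \<rho>" and "\<And>A. finite A \<Longrightarrow> A \<subseteq> I \<Longrightarrow> (\<Sum>k\<in>A. M (\<bar>x k\<bar> / \<rho>)) \<le> 1"
proof -
  obtain \<sigma> where \<sigma>: "0 < \<sigma>" "\<sigma> < \<rho>" "(\<Sum>\<^sub>\<infinity>k\<in>I. ennreal (M (\<bar>x k\<bar> / \<sigma>))) \<le> 1"
    using assms unfolding luxemburg_norm_def Inf_less_iff by auto
  then show "0 < \<rho>" by simp
  fix A assume A: "finite A" "A \<subseteq> I"
  have "(\<Sum>k\<in>A. M (\<bar>x k\<bar> / \<rho>)) \<le> (\<Sum>k\<in>A. M (\<bar>x k\<bar> / \<sigma>))"
    using \<sigma> by (intro sum_mono M_mono) (auto intro!: divide_left_mono)
  also have "\<dots> \<le> 1"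
    using \<sigma> A infsum_le_1_iff[of \<sigma> x I] by simp
  finally show "(\<Sum>k\<in>A. M (\<bar>x k\<bar> / \<rho>)) \<le> 1" .
qed

text \<open>
  If \<open>\<rho>\<close> is admissible for \<open>x\<close>, then \<open>M (\<bar>x k\<bar> / \<rho>) \<le> 1\<close>; as \<open>M\<close> is unbounded, this keeps \<open>\<rho>\<close> away from \<open>0\<close>.
\<close>

lemma luxemburg_norm_pos:
  assumes "k \<in> I" "x k \<noteq> 0"
  shows "0 < luxemburg_norm M I x"
proof -
  obtain R where R: "\<And>t. 0 \<le> t \<Longrightarrow> M t \<le> 1 \<Longrightarrow> t \<le> R"
    using bounded_sublevel by blast
  define r where "r = \<bar>x k\<bar> / max R 1"
  have "0 < r" using assms(2) by (simp add: r_def)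
  moreover have "\<not> luxemburg_norm M I x < ereal r"
  proof
    assume *: "luxemburg_norm M I x < ereal r"
    then obtain \<rho> where \<rho>: "luxemburg_norm M I x < ereal \<rho>" "\<rho> < r"
      using ereal_dense2 by force
    from luxemburg_normD(2)[OF \<rho>(1), of "{k}"] luxemburg_normD(1)[OF \<rho>(1)] assms(1)
    have "\<bar>x k\<bar> / \<rho> \<le> max R 1" "0 < \<rho>" using R[of "\<bar>x k\<bar> / \<rho>"] by auto
    then have "r \<le> \<rho>" unfolding r_def by (simp add: field_simps)
    then show False using \<rho>(2) by simp
  qed
  ultimately show ?thesis
    by (metis ereal_less(2) linorder_not_less order_less_le_trans)
qed

lemma luxemburg_norm_scale:
  assumes "luxemburg_norm M I x < ereal p" "c \<noteq> 0"
  shows "luxemburg_norm M I (\<lambda>k. c * x k) \<le> ereal (\<bar>c\<bar> * p)"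
  using luxemburg_normD[OF assms(1)] assms(2)
  by (intro luxemburg_normI) (auto simp: abs_mult)

section \<open>Growth of the norm along disjoint and overlapping directions\<close>

text \<open>
  At the level \<open>\<rho> = n (1 + s\<^sup>3) / (1 - s\<^sup>3)\<close>, the part carried by \<open>f\<close> has modular at most \<open>1 - s\<^sup>3\<close> by
  the contraction \<open>M (\<theta> t) \<le> \<theta> M t\<close> for \<open>\<theta> \<in> [0,1]\<close>, and the part carried by \<open>c g\<close> has modular at most
  \<open>s\<^sup>3\<close>. The factor \<open>1 + s\<^sup>3\<close> leaves room above \<open>\<parallel>f\<parallel>\<close>, so that the infimum in the norm need not be
  attained.
\<close>

lemma luxemburg_norm_add_disjoint:
  assumes disj: "disjoint_seqs f g"
    and f: "luxemburg_norm M I f < ereal (n * (1 + s ^ 3))"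
    and g: "luxemburg_norm M I g < ereal n"
    and s: "0 < s" "s < 1" "\<bar>c\<bar> = s"
  shows "luxemburg_norm M I (\<lambda>k. f k + c * g k) \<le> ereal (n * (1 + s ^ 3) / (1 - s ^ 3))"
proof (rule luxemburg_normI)
  let ?\<rho> = "n * (1 + s ^ 3) / (1 - s ^ 3)"
  have n: "0 < n" using luxemburg_normD(1)[OF g] .
  have s3: "0 < s ^ 3" "s ^ 3 < 1" using s by (auto simp: power_less_one_iff)
  have n_le: "n \<le> ?\<rho>" using n s3 by (simp add: field_simps)
  show rho: "0 < ?\<rho>" using n n_le by linarith
  fix A assume A: "finite A" "A \<subseteq> I"
  have M0: "0 \<le> M t" if "0 \<le> t" for t using D_nonneg[of 0] that by (simp add: D_0)
  have "M (\<bar>f k + c * g k\<bar> / ?\<rho>) \<le>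
      (1 - s ^ 3) * M (\<bar>f k\<bar> / (n * (1 + s ^ 3))) + s ^ 3 * M (\<bar>g k\<bar> / n)" for k
  proof (cases "g k = 0")
    case True
    have "M (\<bar>f k\<bar> / ?\<rho>) = M ((1 - s ^ 3) * (\<bar>f k\<bar> / (n * (1 + s ^ 3))))"
      by (simp add: mult.commute)
    also have "\<dots> \<le> (1 - s ^ 3) ^ 3 * M (\<bar>f k\<bar> / (n * (1 + s ^ 3)))"
      using s3 n by (intro cubic_contraction) auto
    also have "\<dots> \<le> (1 - s ^ 3) * M (\<bar>f k\<bar> / (n * (1 + s ^ 3)))"
      using s3 n power_decreasing[of 1 3 "1 - s ^ 3"] by (intro mult_right_mono M0) auto
    finally show ?thesis using True M0[of 0] s3 by (simp add: add_increasing2)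
  next
    case False
    then have [simp]: "f k = 0" using disj by (auto simp: disjoint_seqs_def)
    have "M (\<bar>c * g k\<bar> / ?\<rho>) \<le> M (\<bar>c * g k\<bar> / n)"
      using n n_le rho by (intro M_mono divide_left_mono divide_nonneg_pos mult_pos_pos abs_ge_zero)
    also have "\<dots> = M (s * (\<bar>g k\<bar> / n))"
      using s by (simp add: abs_mult)
    also have "\<dots> \<le> s ^ 3 * M (\<bar>g k\<bar> / n)"
      using s n by (intro cubic_contraction) auto
    finally show ?thesis using M0[of 0] s3 by (simp add: add_increasing)
  qed
  then have "(\<Sum>k\<in>A. M (\<bar>f k + c * g k\<bar> / ?\<rho>)) \<le>
      (1 - s ^ 3) * (\<Sum>k\<in>A. M (\<bar>f k\<bar> / (n * (1 + s ^ 3)))) + s ^ 3 * (\<Sum>k\<in>A. M (\<bar>g k\<bar> / n))"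
    unfolding sum_distrib_left sum.distrib[symmetric] by (intro sum_mono)
  also have "\<dots> \<le> (1 - s ^ 3) * 1 + s ^ 3 * 1"
    using luxemburg_normD(2)[OF f A] luxemburg_normD(2)[OF g A] s3
    by (intro add_mono mult_left_mono) auto
  finally show "(\<Sum>k\<in>A. M (\<bar>f k + c * g k\<bar> / ?\<rho>)) \<le> 1" by simp
qed

text \<open>
  If the cubic bound held for both signs and all small \<open>s\<close>, then at a level \<open>\<nu>\<close> slightly above it the
  second difference would give \<open>F\<close> a modular of at most \<open>1 - \<kappa> s\<^sup>2 / 2\<close>. Passing from \<open>\<nu>\<close> down to the level
  \<open>n (1 - s\<^sup>3) < n\<close> multiplies the modular at most by \<open>1 / (1 - 4 C s\<^sup>3)\<close>, which the quadratic deficit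
  absorbs for small \<open>s\<close>. So \<open>n (1 - s\<^sup>3)\<close> would be admissible for \<open>F\<close>, although \<open>\<parallel>F\<parallel> = n\<close>.
\<close>

lemma luxemburg_norm_add_overlapping:
  assumes F: "luxemburg_norm M I F = ereal n"
    and k0: "k0 \<in> I" "F k0 \<noteq> 0" "G k0 \<noteq> 0"
  shows "\<exists>s c. 0 < s \<and> s < 1 \<and> \<bar>c\<bar> = s \<and>
    ereal (n * (1 + s ^ 3) / (1 - s ^ 3)) < luxemburg_norm M I (\<lambda>k. F k + c * G k)"
proof (rule ccontr)
  assume contra: "\<not> ?thesis"
  have upper: "luxemburg_norm M I (\<lambda>k. F k + c * G k) \<le> ereal (n * (1 + s ^ 3) / (1 - s ^ 3))"
    if "0 < s" "s < 1" "\<bar>c\<bar> = s" for s c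
    using contra that linorder_not_less by blast
  have n: "0 < n"
    using luxemburg_norm_pos[of k0 I F] k0 F by simp
  have M0: "0 \<le> M t" if "0 \<le> t" for t using D_nonneg[of 0] that by (simp add: D_0)
  obtain R where R: "\<And>t. 0 \<le> t \<Longrightarrow> M t \<le> 1 \<Longrightarrow> t \<le> R"
    using bounded_sublevel by blast
  obtain C where C: "0 \<le> C"
    "\<And>\<mu> t. 0 \<le> \<mu> \<Longrightarrow> \<mu> \<le> 1 \<Longrightarrow> 0 \<le> t \<Longrightarrow> t \<le> 4 * R \<Longrightarrow> (1 - (1 - \<mu>) * C) * M t \<le> M (\<mu> * t)"
    using delta2_lower[of "4 * R"] by metis
  obtain m where m: "0 < m"
    "\<And>x h. \<bar>F k0\<bar> / (2 * n) \<le> x \<Longrightarrow> 0 \<le> h \<Longrightarrow> h \<le> x / 2 \<Longrightarrow>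
       2 * M x + m * h\<^sup>2 \<le> M (x + h) + M (x - h)"
    using strong_midpoint_convex[of "\<bar>F k0\<bar> / (2 * n)"] n k0 by auto
  define \<kappa> where "\<kappa> = m * (\<bar>G k0\<bar> / (2 * n))\<^sup>2"
  have \<kappa>: "0 < \<kappa>" using m(1) n k0 by (simp add: \<kappa>_def)
  \<comment> \<open>The four bounds ensure, in this order: \<open>\<nu> \<le> 2 n\<close>; \<open>s \<bar>G k0\<bar> \<le> \<bar>F k0\<bar> / 2\<close>;
    the cubic error is dominated by \<open>\<kappa> s\<^sup>2\<close>; and \<open>1 - 4 C s\<^sup>3 > 0\<close>.\<close>
  define s where "s = Min {1 / 5, \<bar>F k0\<bar> / (2 * \<bar>G k0\<bar>), \<kappa> / (8 * C + 1), 1 / (4 * C + 1)}"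
  have s0: "0 < s" using \<kappa> C(1) k0 by (auto simp: s_def)
  have "s \<le> 1 / 5" "s \<le> \<bar>F k0\<bar> / (2 * \<bar>G k0\<bar>)" "s \<le> \<kappa> / (8 * C + 1)" "s \<le> 1 / (4 * C + 1)"
    unfolding s_def by (rule Min_le; simp)+
  then have s: "s \<le> 1 / 5" "s * \<bar>G k0\<bar> \<le> \<bar>F k0\<bar> / 2" "8 * C * s \<le> \<kappa>" "4 * C * s < 1"
    using s0 k0 C(1) by (auto simp: field_simps)
  define \<epsilon> where "\<epsilon> = s ^ 3"
  have \<epsilon>: "0 < \<epsilon>" "\<epsilon> \<le> s" "\<epsilon> \<le> 1 / 5"
    using s0 s(1) power_decreasing[of 1 3 s] by (auto simp: \<epsilon>_def)
  have C\<epsilon>: "4 * \<epsilon> * C < 1" "8 * \<epsilon> * C \<le> \<kappa> * s\<^sup>2"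
  proof -
    have "4 * \<epsilon> * C \<le> 4 * s * C" using \<epsilon> C(1) by (intro mult_right_mono) auto
    then show "4 * \<epsilon> * C < 1" using s(4) by (simp add: mult_ac)
    have "8 * C * s * s\<^sup>2 \<le> \<kappa> * s\<^sup>2" using s(3) by (intro mult_right_mono) auto
    then show "8 * \<epsilon> * C \<le> \<kappa> * s\<^sup>2" by (simp add: \<epsilon>_def power3_eq_cube power2_eq_square mult_ac)
  qed
  \<comment> \<open>The denominator \<open>1 - 2 \<epsilon>\<close> instead of \<open>1 - \<epsilon>\<close> makes \<open>\<nu>\<close> strictly larger than the norms of
    \<open>F \<plusminus> s G\<close>, hence admissible for both.\<close>
  define \<nu> where "\<nu> = n * (1 + \<epsilon>) / (1 - 2 * \<epsilon>)"
  have \<nu>: "0 < \<nu>" "\<nu> \<le> 2 * n"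
    using n \<epsilon> mult_left_mono[of "5 * \<epsilon>" 1 n]
    by (auto simp: \<nu>_def divide_le_eq algebra_simps intro!: mult_pos_pos divide_pos_pos add_pos_pos)
  have "n * (1 + s ^ 3) / (1 - s ^ 3) < \<nu>"
    using n \<epsilon> unfolding \<nu>_def \<epsilon>_def[symmetric] by (intro divide_strict_left_mono) auto
  then have "luxemburg_norm M I (\<lambda>k. F k + c * G k) < ereal \<nu>" if "\<bar>c\<bar> = s" for c
    using upper[of s c] s0 s(1) that by (simp add: le_less_trans)
  note perturbed = luxemburg_normD(2)[OF this]
  \<comment> \<open>The coordinates of \<open>F\<close> are bounded, so one constant \<open>C\<close> serves all of them.\<close>
  have bound: "\<bar>F k\<bar> / (n * (1 - \<epsilon>)) \<le> 4 * R" if "k \<in> I" for k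
  proof -
    have "M (\<bar>F k\<bar> / (2 * n)) \<le> 1"
      using luxemburg_normD(2)[of I F "2 * n" "{k}"] F n that by simp
    then have R_bound: "\<bar>F k\<bar> / (2 * n) \<le> R" using R n by simp
    have "\<bar>F k\<bar> / (n * (1 - \<epsilon>)) \<le> \<bar>F k\<bar> / (n * (1 / 2))"
      using n \<epsilon> by (intro divide_left_mono mult_left_mono mult_pos_pos) auto
    also have "\<dots> = 4 * (\<bar>F k\<bar> / (2 * n))"
      by simp
    also have "\<dots> \<le> 4 * R"
      by (rule mult_left_mono[OF R_bound]) simp
    finally show ?thesis .
  qed
  have shrink: "(1 - 4 * \<epsilon> * C) * M (\<bar>F k\<bar> / (n * (1 - \<epsilon>))) \<le> M (\<bar>F k\<bar> / \<nu>)" if "k \<in> I" for k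
  proof -
    \<comment> \<open>The ratio of the levels \<open>n (1 - \<epsilon>)\<close> and \<open>\<nu>\<close>.\<close>
    define \<mu> where "\<mu> = (1 - \<epsilon>) * (1 - 2 * \<epsilon>) / (1 + \<epsilon>)"
    have "(1 - \<epsilon>) * (1 - 2 * \<epsilon>) = 1 - 3 * \<epsilon> + 2 * (\<epsilon> * \<epsilon>)" by (simp add: algebra_simps)
    moreover have "\<epsilon> * \<epsilon> \<le> \<epsilon>" using \<epsilon> by (simp add: mult_left_le)
    moreover have "(1 - 4 * \<epsilon>) * (1 + \<epsilon>) = 1 - 3 * \<epsilon> - 4 * (\<epsilon> * \<epsilon>)" by (simp add: algebra_simps)
    ultimately have \<mu>: "0 \<le> \<mu>" "\<mu> \<le> 1" "1 - 4 * \<epsilon> \<le> \<mu>"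
      using \<epsilon> by (auto simp: \<mu>_def le_divide_eq divide_le_eq)
    have "1 - 4 * \<epsilon> * C \<le> 1 - (1 - \<mu>) * C"
      using \<mu> C(1) mult_right_mono[of "1 - \<mu>" "4 * \<epsilon>" C] by simp
    then have "(1 - 4 * \<epsilon> * C) * M (\<bar>F k\<bar> / (n * (1 - \<epsilon>))) \<le>
        (1 - (1 - \<mu>) * C) * M (\<bar>F k\<bar> / (n * (1 - \<epsilon>)))"
      using n \<epsilon> by (intro mult_right_mono M0) auto
    also have "\<dots> \<le> M (\<mu> * (\<bar>F k\<bar> / (n * (1 - \<epsilon>))))"
      using n \<epsilon> \<mu> by (intro C(2) bound[OF that]) auto
    also have "\<mu> * (\<bar>F k\<bar> / (n * (1 - \<epsilon>))) = \<bar>F k\<bar> / \<nu>"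
      using n \<epsilon> by (simp add: mult.commute \<mu>_def \<nu>_def)
    finally show ?thesis .
  qed
  have second_difference: "2 * M (\<bar>F k\<bar> / \<nu>) \<le> M (\<bar>F k + s * G k\<bar> / \<nu>) + M (\<bar>F k + (- s) * G k\<bar> / \<nu>)" for k
    using midpoint_convex[of "F k / \<nu>" "s * G k / \<nu>"] \<nu>(1)
    by (simp add: add_divide_distrib[symmetric] diff_divide_distrib[symmetric])
  have strict: "2 * M (\<bar>F k0\<bar> / \<nu>) + \<kappa> * s\<^sup>2 \<le>
      M (\<bar>F k0 + s * G k0\<bar> / \<nu>) + M (\<bar>F k0 + (- s) * G k0\<bar> / \<nu>)"
  proof -
    let ?x = "\<bar>F k0\<bar> / \<nu>" and ?h = "s * \<bar>G k0\<bar> / \<nu>"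
    have "\<kappa> * s\<^sup>2 = m * (s * \<bar>G k0\<bar> / (2 * n))\<^sup>2"
      by (simp add: \<kappa>_def power_mult_distrib power_divide)
    also have "\<dots> \<le> m * ?h\<^sup>2"
      using m(1) \<nu> s0 n by (intro mult_left_mono power_mono divide_left_mono) auto
    finally have "2 * M ?x + \<kappa> * s\<^sup>2 \<le> 2 * M ?x + m * ?h\<^sup>2" by simp
    also have "\<dots> \<le> M (?x + ?h) + M (?x - ?h)"
    proof (rule m(2))
      show "\<bar>F k0\<bar> / (2 * n) \<le> ?x" using \<nu> n by (intro divide_left_mono) auto
      show "0 \<le> ?h" using \<nu> s0 by simp
      show "?h \<le> ?x / 2" using divide_right_mono[OF s(2), of \<nu>] \<nu> by simp
    qed
    also have "?x + ?h = (\<bar>F k0\<bar> + s * \<bar>G k0\<bar>) / \<nu>" by (simp add: add_divide_distrib)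
    also have "?x - ?h = (\<bar>F k0\<bar> - s * \<bar>G k0\<bar>) / \<nu>" by (simp add: diff_divide_distrib)
    also have "M ((\<bar>F k0\<bar> + s * \<bar>G k0\<bar>) / \<nu>) + M ((\<bar>F k0\<bar> - s * \<bar>G k0\<bar>) / \<nu>) =
        M (\<bar>F k0 + s * G k0\<bar> / \<nu>) + M (\<bar>F k0 + (- s) * G k0\<bar> / \<nu>)"
    proof -
      have "\<bar>s * G k0\<bar> \<le> \<bar>F k0\<bar>" using s(2) s0 by (simp add: abs_mult)
      then have "\<bar>F k0\<bar> + \<bar>s * G k0\<bar> = \<bar>F k0 + s * G k0\<bar> \<and> \<bar>F k0\<bar> - \<bar>s * G k0\<bar> = \<bar>F k0 - s * G k0\<bar> \<or>
          \<bar>F k0\<bar> + \<bar>s * G k0\<bar> = \<bar>F k0 - s * G k0\<bar> \<and> \<bar>F k0\<bar> - \<bar>s * G k0\<bar> = \<bar>F k0 + s * G k0\<bar>"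
        by (auto simp: abs_if)
      then show ?thesis using s0 by (auto simp: abs_mult)
    qed
    finally show ?thesis .
  qed
  have "luxemburg_norm M I F \<le> ereal (n * (1 - \<epsilon>))"
  proof (rule luxemburg_normI)
    show "0 < n * (1 - \<epsilon>)" using n \<epsilon> by simp
    fix A assume A: "finite A" "A \<subseteq> I"
    \<comment> \<open>The coordinate \<open>k0\<close>, which produces the deficit, has to take part in the finite sum.\<close>
    define B where "B = insert k0 A"
    have B: "finite B" "B \<subseteq> I" "k0 \<in> B" using A k0 by (auto simp: B_def)
    let ?P = "\<lambda>k. M (\<bar>F k + s * G k\<bar> / \<nu>) + M (\<bar>F k + (- s) * G k\<bar> / \<nu>)"
    have "2 * (\<Sum>k\<in>B. M (\<bar>F k\<bar> / \<nu>)) + \<kappa> * s\<^sup>2 =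
        (2 * M (\<bar>F k0\<bar> / \<nu>) + \<kappa> * s\<^sup>2) + (\<Sum>k\<in>B - {k0}. 2 * M (\<bar>F k\<bar> / \<nu>))"
      using B by (simp add: sum.remove[of B k0] sum_distrib_left algebra_simps)
    also have "\<dots> \<le> ?P k0 + (\<Sum>k\<in>B - {k0}. ?P k)"
      by (intro add_mono[OF strict] sum_mono second_difference)
    also have "\<dots> = (\<Sum>k\<in>B. ?P k)"
      using B by (simp add: sum.remove[of B k0])
    also have "\<dots> \<le> 1 + 1"
      unfolding sum.distrib using perturbed[of s, OF _ B(1,2)] perturbed[of "- s", OF _ B(1,2)] s0
      by (intro add_mono) auto
    finally have small: "(\<Sum>k\<in>B. M (\<bar>F k\<bar> / \<nu>)) \<le> 1 - \<kappa> * s\<^sup>2 / 2" by simp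
    let ?S = "\<Sum>k\<in>B. M (\<bar>F k\<bar> / (n * (1 - \<epsilon>)))"
    have "(1 - 4 * \<epsilon> * C) * ?S \<le> (\<Sum>k\<in>B. M (\<bar>F k\<bar> / \<nu>))"
      unfolding sum_distrib_left using B shrink by (intro sum_mono) auto
    also have "\<dots> \<le> (1 - 4 * \<epsilon> * C) * 1" using small C\<epsilon>(2) by simp
    finally have "?S \<le> 1" using C\<epsilon>(1) by (simp add: mult_le_cancel_left)
    moreover have "(\<Sum>k\<in>A. M (\<bar>F k\<bar> / (n * (1 - \<epsilon>)))) \<le> ?S"
      using B n \<epsilon> by (intro sum_mono2 M0) (auto simp: B_def)
    ultimately show "(\<Sum>k\<in>A. M (\<bar>F k\<bar> / (n * (1 - \<epsilon>)))) \<le> 1" by simp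
  qed
  then show False using F n \<epsilon> by simp
qed

end

section \<open>Isometric embeddings\<close>

theorem corollary1p7:
  fixes M\<^sub>1 M\<^sub>2 :: "real \<Rightarrow> real"
    and I :: "nat set"
    and T :: "(nat \<Rightarrow> real) \<Rightarrow> (nat \<Rightarrow> real)"
  assumes "\<And>M. M \<in> {M\<^sub>1, M\<^sub>2} \<Longrightarrow> orlicz_function M"
    and "\<And>M. M \<in> {M\<^sub>1, M\<^sub>2} \<Longrightarrow> C3_half_line M"
    and "\<And>M. M \<in> {M\<^sub>1, M\<^sub>2} \<Longrightarrow> mono_on {0..} (half_line_deriv 3 M)"
    and "\<And>M. M \<in> {M\<^sub>1, M\<^sub>2} \<Longrightarrow> M \<in> o[at_right 0](\<lambda>t. t ^ 3)"
    and "\<And>M. M \<in> {M\<^sub>1, M\<^sub>2} \<Longrightarrow> delta2pp_at_0 M"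
    and "I = UNIV \<or> (\<exists>n. I = {..<n})"
    and "linear_isometric_embedding M\<^sub>1 I M\<^sub>2 UNIV T"
  shows "\<forall>f\<in>orlicz_space_on M\<^sub>1 I. \<forall>g\<in>orlicz_space_on M\<^sub>1 I.
           disjoint_seqs f g \<longrightarrow> disjoint_seqs (T f) (T g)"
proof (intro ballI impI, rule ccontr)
  fix f g
  assume f: "f \<in> orlicz_space_on M\<^sub>1 I" and g: "g \<in> orlicz_space_on M\<^sub>1 I"
    and disj: "disjoint_seqs f g" and "\<not> disjoint_seqs (T f) (T g)"
  then obtain k where k: "T f k \<noteq> 0" "T g k \<noteq> 0"
    by (auto simp: disjoint_seqs_def)
  interpret M1: smooth_orlicz M\<^sub>1 using assms(1-5) by unfold_locales auto
  interpret M2: smooth_orlicz M\<^sub>2 using assms(1-5) by unfold_locales auto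
  let ?X = "orlicz_space_on M\<^sub>1 I"
  have T_add: "T (\<lambda>k. x k + y k) = (\<lambda>k. T x k + T y k)" if "x \<in> ?X" "y \<in> ?X" for x y
    using assms(7) that unfolding linear_isometric_embedding_def by blast
  have T_scale: "T (\<lambda>k. c * x k) = (\<lambda>k. c * T x k)" if "x \<in> ?X" for x c
    using assms(7) that unfolding linear_isometric_embedding_def by blast
  have T_norm: "luxemburg_norm M\<^sub>2 UNIV (T x) = luxemburg_norm M\<^sub>1 I x" if "x \<in> ?X" for x
    using assms(7) that unfolding linear_isometric_embedding_def by blast
  have finite_norm: "x \<in> ?X" if "luxemburg_norm M\<^sub>1 I x \<le> ereal r" "\<And>k. k \<notin> I \<Longrightarrow> x k = 0" for x r
    using that by (auto simp: orlicz_space_on_def intro: le_less_trans)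
  have outside: "f k = 0" "g k = 0" if "k \<notin> I" for k
    using f g that by (auto simp: orlicz_space_on_def)
  have "0 < luxemburg_norm M\<^sub>1 I f" "luxemburg_norm M\<^sub>1 I f < \<infinity>"
    using M2.luxemburg_norm_pos[of k UNIV "T f"] k T_norm[OF f] f by (auto simp: orlicz_space_on_def)
  then obtain n where n: "luxemburg_norm M\<^sub>1 I f = ereal n" "0 < n"
    by (cases "luxemburg_norm M\<^sub>1 I f") auto
  obtain p where p: "luxemburg_norm M\<^sub>1 I g < ereal p"
    using g ereal_dense2[of "luxemburg_norm M\<^sub>1 I g" \<infinity>] by (auto simp: orlicz_space_on_def)
  have p0: "0 < p" using M1.luxemburg_normD(1)[OF p] .
  \<comment> \<open>Rescaling \<open>g\<close> to norm below \<open>n\<close> makes the two growth estimates comparable.\<close>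
  define q where "q = n / (2 * p)"
  have q: "0 < q" using n p0 by (simp add: q_def)
  have "luxemburg_norm M\<^sub>1 I (\<lambda>k. q * g k) \<le> ereal (n / 2)"
    using M1.luxemburg_norm_scale[OF p, of q] q p0 n(2) by (simp add: q_def)
  then have g': "luxemburg_norm M\<^sub>1 I (\<lambda>k. q * g k) < ereal n" "(\<lambda>k. q * g k) \<in> ?X"
    using n(2) outside by (auto intro: le_less_trans finite_norm)
  have norm_F: "luxemburg_norm M\<^sub>2 UNIV (T f) = ereal n"
    using T_norm[OF f] n by simp
  have Tg: "T (\<lambda>k. q * g k) k \<noteq> 0"
    using T_scale[OF g] k q by simp
  obtain s c where s: "0 < s" "s < 1" "\<bar>c\<bar> = s" and large:
    "ereal (n * (1 + s ^ 3) / (1 - s ^ 3)) < luxemburg_norm M\<^sub>2 UNIV (\<lambda>j. T f j + c * T (\<lambda>k. q * g k) j)"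
    using M2.luxemburg_norm_add_overlapping[OF norm_F UNIV_I, of k "T (\<lambda>k. q * g k)"] k Tg by blast
  have cg: "(\<lambda>k. c * (q * g k)) \<in> ?X"
    using M1.luxemburg_norm_scale[OF g'(1), of c] s outside by (intro finite_norm) auto
  have small: "luxemburg_norm M\<^sub>1 I (\<lambda>k. f k + c * (q * g k)) \<le> ereal (n * (1 + s ^ 3) / (1 - s ^ 3))"
    using disj n s g'(1)
    by (intro M1.luxemburg_norm_add_disjoint) (auto simp: disjoint_seqs_def)
  then have "(\<lambda>k. f k + c * (q * g k)) \<in> ?X"
    by (rule finite_norm) (simp add: outside)
  from T_norm[OF this] small large show False
    unfolding T_add[OF f cg] T_scale[OF g'(2)] by simp
qed

end
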